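(* Let $\psi$ be a distribution on $\mathbb{R}^d$ with $\mathrm{supp}\,\psi\subseteq K$, $K$ compact, let $N=\mathrm{order}(\psi)+2d$, and let $V$ be an open set with compact closure, containing $K$, such that $\psi=\sum_{|\alpha|\le N}\partial^\alpha g_\alpha$ with $g_\alpha$ continuous and $\mathrm{supp}\,g_\alpha\subseteq V$. Let $\{Z_t(\psi)\}_{t\ge 0}$ be the $\mathcal{E}'$-valued process defined by $$Z_t(\omega)(\psi)=\sum_{|\alpha|\le N}(-1)^{|\alpha|}\sum_{|\gamma|\le|\alpha|}(-1)^{|\gamma|}\int_V g_\alpha(x)\,P_{\gamma}\big((\partial^{\beta^1}X_1,\dots,\partial^{\beta^d}X_d)_{|\beta^i|\le|\alpha|}\big)(t,x,\omega)\,\partial^\gamma\delta_{X(t,x,\omega)}\,dx$$ for $\omega$ outside a null set $\tilde N$, and $Z_t(\omega)(\psi)=0$ for $\omega\in\tilde N$. Let $\lambda>0$ be such that $V\subseteq\overline{B(0,\lambda)}$, and for $R\ge 0$ let $$\tau_R:=\inf\Big\{t>0:\ \sup_{s\in[0,t]}\ \sup_{|x|\le\lambda}|X(s,x)|\ge R\Big\}.$$ Then the process $\{Z_t(\psi)\}$ is locally of compact support. Furthermore, (1) $t\le\tau_R$ implies $\mathrm{supp}(Z_t(\psi))\subseteq\overline{B(0,R)}$; (2) as $R\uparrow\infty$, $\tau_R\uparrow\infty$.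
   Context: Let $\Omega=C([0,\infty),\mathbb{R}^r)$ with Borel $\sigma$-field $\mathcal{F}$ and Wiener measure $P$, and let $B_t(\omega)=\omega(t)$, a standard $r$-dimensional Brownian motion under $P$. Let $\sigma=(\sigma_{ij})$ ($1\le i\le d$, $1\le j\le r$) and $b=(b_1,\dots,b_d)$ have $C^\infty$ entries on $\mathbb{R}^d$ with bounded derivatives (so they have at most linear growth). $X(t,x)=X(t,x,\omega)$ denotes the solution of $dX_t=\sigma(X_t)\cdot dB_t+b(X_t)\,dt$, $X_0=x$, in the modification for which, for all $\omega$ outside a null set $\tilde N$, $x\mapsto X(t,x,\omega)$ is a $C^\infty$ diffeomorphism of $\mathbb{R}^d$ for all $t\ge0$; $X_1,\dots,X_d$ are its components. $\mathcal{E}'$ is the space of distributions on $\mathbb{R}^d$ with compact support (dual of $C^\infty(\mathbb{R}^d)$). $\overline{B(0,R)}$ is the closed ball of radius $R$ centred at $0$ in $\mathbb{R}^d$; $\delta_y$ is the Dirac distribution at $y$. For each multi-index $\alpha$, the $P_{\gamma}$ ($|\gamma|\le|\alpha|$) are the chain-rule polynomials, i.e. polynomials in finitely many variables with $\deg P_{\gamma}=|\gamma|$ such that for $\varphi\in C^\infty(\mathbb{R}^d)$ and $f=(f_1,\dots,f_d)$ with $f_i\in C^\infty(\mathbb{R}^d)$, $$\partial^\alpha(\varphi\circ f)(x)=\sum_{|\gamma|\le|\alpha|}(-1)^{|\gamma|}P_{\gamma}\big((\partial^{\beta^1}f_1,\dots,\partial^{\beta^d}f_d)_{|\beta^i|\le|\alpha|}\big)(x)\,\langle\varphi,\partial^\gamma\delta_{f(x)}\rangle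 ,$$ where $\beta^1,\dots,\beta^d$ are multi-indices with $d$ components. In the definition of $Z_t$ the derivatives of $X$ are in the variable $x$. An $\mathcal{E}'$-valued process $\{Y_t\}$ is locally of compact support if there exist an increasing sequence of stopping times $\tau_n\uparrow\infty$ and an increasing family of compact sets $K_n$ such that for each $n$, a.s., $\mathrm{supp}(Y_{t\wedge\tau_n})\subset K_n$ for all $t$.
   Formalization: Claim (1) excludes t=0 with R<λ: there τ_R=0 and Z_0(ψ)=ψ, so it fails, e.g. for ψ=δ_y with R<|y|<λ. The flow modification is taken jointly continuous in (t,x) with X(0,x)=x off the null set, as holds after enlarging that null set. *)

theory Defs
  imports "HOL-Probability.Probability" "HOL-Library.Poly_Mapping"
begin

section \<open>Smooth functions and multi-indices\<close>

text \<open>Multi-indices with \<open>d = CARD('d)\<close> components are functions \<open>'d \<Rightarrow> nat\<close>.\<close>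

definition midx_len :: "('d::finite \<Rightarrow> nat) \<Rightarrow> nat" where
  "midx_len \<alpha> = (\<Sum>i\<in>UNIV. \<alpha> i)"

definition partial :: "'d::finite \<Rightarrow> (real^'d \<Rightarrow> real) \<Rightarrow> real^'d \<Rightarrow> real" where
  "partial i f x = deriv (\<lambda>h. f (x + h *\<^sub>R axis i 1)) 0"

primrec partials :: "'d::finite list \<Rightarrow> (real^'d \<Rightarrow> real) \<Rightarrow> real^'d \<Rightarrow> real" where
  "partials [] f = f"
| "partials (i # is) f = partial i (partials is f)"

definition smooth :: "(real^'d::finite \<Rightarrow> real) \<Rightarrow> bool" where
  "smooth f \<longleftrightarrow> (\<forall>is. continuous_on UNIV (partials is f) \<and>
     (\<forall>i x. (\<lambda>h. partials is f (x + h *\<^sub>R axis i 1)) differentiable (at 0)))"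

text \<open>The index type carries no order, so some arrangement of the directions (direction \<open>i\<close>
  occurring \<open>\<alpha> i\<close> times) is selected; for smooth functions its choice is immaterial
  because partial derivatives commute.\<close>

definition mpartial :: "('d::finite \<Rightarrow> nat) \<Rightarrow> (real^'d \<Rightarrow> real) \<Rightarrow> real^'d \<Rightarrow> real" where
  "mpartial \<alpha> f = partials (SOME is. \<forall>i. count_list is i = \<alpha> i) f"

definition smooth_map :: "(real^'d::finite \<Rightarrow> real^'n::finite) \<Rightarrow> bool" where
  "smooth_map f \<longleftrightarrow> (\<forall>i. smooth (\<lambda>x. f x $ i))"

definition smooth_diffeo :: "(real^'d::finite \<Rightarrow> real^'d) \<Rightarrow> bool" where
  "smooth_diffeo f \<longleftrightarrow> bij f \<and> smooth_map f \<and> smooth_map (inv f)"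

definition fun_supp :: "(real^'d::finite \<Rightarrow> real) \<Rightarrow> (real^'d) set" where
  "fun_supp f = closure {x. f x \<noteq> 0}"

definition test_function :: "(real^'d::finite \<Rightarrow> real) \<Rightarrow> bool" where
  "test_function \<phi> \<longleftrightarrow> smooth \<phi> \<and> compact (fun_supp \<phi>)"


section \<open>Distributions\<close>

text \<open>Distributions are real functionals on functions. Only their values on test functions
  (for compactly supported ones: on smooth functions) are relevant.\<close>

type_synonym 'd functional = "(real^'d \<Rightarrow> real) \<Rightarrow> real"

definition linear_functional_on :: "(real^'d::finite \<Rightarrow> real) set \<Rightarrow> 'd functional \<Rightarrow> bool" where
  "linear_functional_on D T \<longleftrightarrow>
     (\<forall>\<phi>\<in>D. \<forall>\<eta>\<in>D. \<forall>a c. T (\<lambda>x. a * \<phi> x + c * \<eta> x) = a * T \<phi> + c * T \<eta>)"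

definition seminorm_bound ::
    "(real^'d::finite \<Rightarrow> real) set \<Rightarrow> (real^'d) set \<Rightarrow> nat \<Rightarrow> real \<Rightarrow> 'd functional \<Rightarrow> bool" where
  "seminorm_bound D K k C T \<longleftrightarrow>
     (\<forall>\<phi>\<in>D. \<bar>T \<phi>\<bar> \<le> C * (\<Sum>\<alpha> | midx_len \<alpha> \<le> k. SUP x\<in>K. \<bar>mpartial \<alpha> \<phi> x\<bar>))"

definition distribution :: "'d::finite functional \<Rightarrow> bool" where
  "distribution T \<longleftrightarrow> linear_functional_on {\<phi>. test_function \<phi>} T \<and>
     (\<forall>K. compact K \<longrightarrow>
        (\<exists>k C. seminorm_bound {\<phi>. test_function \<phi> \<and> fun_supp \<phi> \<subseteq> K} UNIV k C T))"

text \<open>The order: the least \<open>k\<close> that serves all compact sets simultaneously. It exists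
  whenever the distribution has compact support.\<close>

definition dist_order :: "'d::finite functional \<Rightarrow> nat" where
  "dist_order T = (LEAST k. \<forall>K. compact K \<longrightarrow>
     (\<exists>C. seminorm_bound {\<phi>. test_function \<phi> \<and> fun_supp \<phi> \<subseteq> K} UNIV k C T))"

definition dist_supp :: "'d::finite functional \<Rightarrow> (real^'d) set" where
  "dist_supp T =
     - \<Union>{U. open U \<and> (\<forall>\<phi>. test_function \<phi> \<and> fun_supp \<phi> \<subseteq> U \<longrightarrow> T \<phi> = 0)}"

text \<open>The space \<open>\<E>'\<close>, the dual of \<open>C\<^sup>\<infinity>(\<real>\<^sup>d)\<close> with its usual Frechet topology.
  Nonemptiness of \<open>K\<close> is only there to keep the real suprema meaningful.\<close>

definition compact_distribution :: "'d::finite functional \<Rightarrow> bool" where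
  "compact_distribution T \<longleftrightarrow> linear_functional_on {\<phi>. smooth \<phi>} T \<and>
     (\<exists>K k C. compact K \<and> K \<noteq> {} \<and> seminorm_bound {\<phi>. smooth \<phi>} K k C T)"

definition dist_deriv :: "('d::finite \<Rightarrow> nat) \<Rightarrow> 'd functional \<Rightarrow> 'd functional" where
  "dist_deriv \<alpha> T = (\<lambda>\<phi>. (-1) ^ midx_len \<alpha> * T (mpartial \<alpha> \<phi>))"

definition dist_of_fun :: "(real^'d::finite \<Rightarrow> real) \<Rightarrow> 'd functional" where
  "dist_of_fun g = (\<lambda>\<phi>. LINT x|lborel. g x * \<phi> x)"

definition dirac :: "real^'d::finite \<Rightarrow> 'd functional" where
  "dirac y = (\<lambda>\<phi>. \<phi> y)"


section \<open>Chain-rule polynomials\<close>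

text \<open>Polynomials over the reals in variables \<open>(i, \<beta>)\<close>; the variable \<open>(i, \<beta>)\<close> stands for
  the partial derivative of order \<open>\<beta>\<close> of the component \<open>f\<^sub>i\<close>. The inner finitely supported
  map is a monomial (exponents), the outer one gives the coefficients.\<close>

type_synonym 'd cpoly = "(('d \<times> ('d \<Rightarrow> nat)) \<Rightarrow>\<^sub>0 nat) \<Rightarrow>\<^sub>0 real"

definition cpoly_eval :: "'d cpoly \<Rightarrow> ('d \<times> ('d \<Rightarrow> nat) \<Rightarrow> real) \<Rightarrow> real" where
  "cpoly_eval p a = (\<Sum>m\<in>Poly_Mapping.keys p.
     Poly_Mapping.lookup p m * (\<Prod>v\<in>Poly_Mapping.keys m. a v ^ Poly_Mapping.lookup m v))"

text \<open>Total degree, with the convention that the zero polynomial has degree \<open>0\<close>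
  (it occurs: the coefficient for \<open>\<gamma> = 0\<close> vanishes if \<open>\<alpha> \<noteq> 0\<close>).\<close>

definition cpoly_degree :: "'d cpoly \<Rightarrow> nat" where
  "cpoly_degree p = Max (insert 0
     ((\<lambda>m. \<Sum>v\<in>Poly_Mapping.keys m. Poly_Mapping.lookup m v) ` Poly_Mapping.keys p))"

definition cpoly_vars :: "'d cpoly \<Rightarrow> ('d \<times> ('d \<Rightarrow> nat)) set" where
  "cpoly_vars p = (\<Union>m\<in>Poly_Mapping.keys p. Poly_Mapping.keys m)"

definition jet :: "(real^'d::finite \<Rightarrow> real^'d) \<Rightarrow> real^'d \<Rightarrow> 'd \<times> ('d \<Rightarrow> nat) \<Rightarrow> real" where
  "jet f x = (\<lambda>(i, \<beta>). mpartial \<beta> (\<lambda>y. f y $ i) x)"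

definition chain_rule_polys ::
    "('d::finite \<Rightarrow> nat) \<Rightarrow> (('d \<Rightarrow> nat) \<Rightarrow> 'd cpoly) \<Rightarrow> bool" where
  "chain_rule_polys \<alpha> P \<longleftrightarrow>
     (\<forall>\<gamma>. midx_len \<gamma> \<le> midx_len \<alpha> \<longrightarrow>
        cpoly_degree (P \<gamma>) = midx_len \<gamma> \<and>
        cpoly_vars (P \<gamma>) \<subseteq> {(i, \<beta>). midx_len \<beta> \<le> midx_len \<alpha>}) \<and>
     (\<forall>\<phi> f x. smooth \<phi> \<and> smooth_map f \<longrightarrow>
        mpartial \<alpha> (\<phi> \<circ> f) x =
          (\<Sum>\<gamma> | midx_len \<gamma> \<le> midx_len \<alpha>.
             (-1) ^ midx_len \<gamma> * cpoly_eval (P \<gamma>) (jet f x) * dist_deriv \<gamma> (dirac (f x)) \<phi>))"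


section \<open>Wiener space\<close>

text \<open>\<open>C([0,\<infinity>), \<real>\<^sup>r)\<close>. Paths are total functions on the reals, made unique by being
  \<open>undefined\<close> at negative times.\<close>

type_synonym 'r path = "real \<Rightarrow> real^'r"

definition path_space :: "'r::finite path set" where
  "path_space = {\<omega> \<in> extensional {0..}. continuous_on {0..} \<omega>}"

text \<open>Open sets for the topology of uniform convergence on compact time intervals.\<close>

definition path_open :: "'r::finite path set \<Rightarrow> bool" where
  "path_open U \<longleftrightarrow> U \<subseteq> path_space \<and>
     (\<forall>\<omega>\<in>U. \<exists>T\<ge>0. \<exists>e>0. \<forall>\<omega>'\<in>path_space. (\<forall>t\<in>{0..T}. dist (\<omega>' t) (\<omega> t) < e) \<longrightarrow> \<omega>' \<in> U)"

definition wiener_measure :: "'r::finite path measure \<Rightarrow> bool" where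
  "wiener_measure W \<longleftrightarrow> prob_space W \<and>
     space W = path_space \<and> sets W = sigma_sets path_space {U. path_open U} \<and>
     (AE \<omega> in W. \<omega> 0 = 0) \<and>
     (\<forall>s t j. 0 \<le> s \<and> s < t \<longrightarrow>
        distributed W lborel (\<lambda>\<omega>. \<omega> t $ j - \<omega> s $ j) (normal_density 0 (sqrt (t - s)))) \<and>
     (\<forall>n p. 0 \<le> p 0 \<and> (\<forall>k<n. p k < p (Suc k)) \<longrightarrow>
        prob_space.indep_vars W (\<lambda>_. borel)
          (\<lambda>(k, j) \<omega>. \<omega> (p (Suc k)) $ j - \<omega> (p k) $ j) ({..<n::nat} \<times> UNIV))"

text \<open>The filtration of the coordinate process, augmented by the null sets of the completed
  measure. Its index set is \<open>[0,\<infinity>]\<close>, so that stopping times may be infinite.\<close>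

definition brownian_filtration :: "'r::finite path measure \<Rightarrow> ennreal \<Rightarrow> 'r path measure" where
  "brownian_filtration W t = sigma (space W)
     ({{\<omega> \<in> space W. \<omega> s \<in> A} | s A. 0 \<le> s \<and> ennreal s \<le> t \<and> A \<in> sets borel} \<union>
      null_sets (completion W))"


section \<open>The Ito integral and stochastic differential equations\<close>

text \<open>Simple integrands \<open>\<Sum>k<m. \<xi>\<^sub>k 1\<^bsub>(p\<^sub>k, p\<^sub>k\<^sub>+\<^sub>1]\<^esub>\<close> with bounded \<open>\<xi>\<^sub>k\<close> known at time \<open>p\<^sub>k\<close>.\<close>

definition simple_integrand ::
    "'r::finite path measure \<Rightarrow> nat \<Rightarrow> (nat \<Rightarrow> real) \<Rightarrow> (nat \<Rightarrow> 'r path \<Rightarrow> real) \<Rightarrow> bool" where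
  "simple_integrand W m p \<xi> \<longleftrightarrow> 0 \<le> p 0 \<and> (\<forall>k<m. p k < p (Suc k) \<and>
     \<xi> k \<in> borel_measurable (brownian_filtration W (ennreal (p k))) \<and>
     (\<exists>C. \<forall>\<omega>\<in>space W. \<bar>\<xi> k \<omega>\<bar> \<le> C))"

definition simple_value ::
    "nat \<Rightarrow> (nat \<Rightarrow> real) \<Rightarrow> (nat \<Rightarrow> 'r path \<Rightarrow> real) \<Rightarrow> real \<Rightarrow> 'r path \<Rightarrow> real" where
  "simple_value m p \<xi> s \<omega> = (\<Sum>k<m. \<xi> k \<omega> * indicator {p k<..p (Suc k)} s)"

definition simple_ito_integral ::
    "'r::finite \<Rightarrow> nat \<Rightarrow> (nat \<Rightarrow> real) \<Rightarrow> (nat \<Rightarrow> 'r path \<Rightarrow> real) \<Rightarrow> real \<Rightarrow> 'r path \<Rightarrow> real" where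
  "simple_ito_integral j m p \<xi> t \<omega> =
     (\<Sum>k<m. \<xi> k \<omega> * (\<omega> (min (p (Suc k)) t) $ j - \<omega> (min (p k) t) $ j))"

definition to_zero_in_probability :: "'a measure \<Rightarrow> (nat \<Rightarrow> 'a \<Rightarrow> ennreal) \<Rightarrow> bool" where
  "to_zero_in_probability M Y \<longleftrightarrow> (\<forall>n. Y n \<in> borel_measurable M) \<and>
     (\<forall>\<epsilon>>0. (\<lambda>n. measure M {\<omega> \<in> space M. ennreal \<epsilon> < Y n \<omega>}) \<longlonglongrightarrow> 0)"

text \<open>\<open>I\<close> is the process \<open>\<integral>\<^sub>0\<^sup>t H\<^sub>s dB\<^sup>j\<^sub>s\<close>: the limit, in probability and uniformly on compact
  time intervals, of the integrals of simple integrands which converge to \<open>H\<close> in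
  \<open>L\<^sup>2([0,T])\<close> in probability, for every \<open>T\<close>.\<close>

definition has_ito_integral ::
    "'r::finite path measure \<Rightarrow> 'r \<Rightarrow> (real \<Rightarrow> 'r path \<Rightarrow> real) \<Rightarrow> (real \<Rightarrow> 'r path \<Rightarrow> real) \<Rightarrow> bool" where
  "has_ito_integral W j H I \<longleftrightarrow>
     (\<forall>t\<ge>0. H t \<in> borel_measurable (brownian_filtration W (ennreal t))) \<and>
     (AE \<omega> in completion W. (\<lambda>s. H s \<omega>) \<in> borel_measurable (restrict_space borel {0..})) \<and>
     (\<forall>t\<ge>0. I t \<in> borel_measurable (brownian_filtration W (ennreal t))) \<and>
     (AE \<omega> in completion W. continuous_on {0..} (\<lambda>t. I t \<omega>)) \<and>
     (\<exists>m p \<xi>. (\<forall>n. simple_integrand W (m n) (p n) (\<xi> n)) \<and>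
        (\<forall>T\<ge>0.
           to_zero_in_probability (completion W) (\<lambda>n \<omega>. \<integral>\<^sup>+s\<in>{0..T}.
             ennreal ((simple_value (m n) (p n) (\<xi> n) s \<omega> - H s \<omega>)\<^sup>2) \<partial>lborel) \<and>
           to_zero_in_probability (completion W) (\<lambda>n \<omega>. SUP t\<in>{0..T}.
             ennreal \<bar>simple_ito_integral j (m n) (p n) (\<xi> n) t \<omega> - I t \<omega>\<bar>)))"

definition sde_solution ::
    "'r::finite path measure \<Rightarrow> (real^'d \<Rightarrow> real^'r^'d) \<Rightarrow> (real^'d \<Rightarrow> real^'d) \<Rightarrow> real^'d::finite \<Rightarrow>
     (real \<Rightarrow> 'r path \<Rightarrow> real^'d) \<Rightarrow> bool" where
  "sde_solution W \<sigma> b x Y \<longleftrightarrow>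
     (\<forall>t\<ge>0. Y t \<in> borel_measurable (brownian_filtration W (ennreal t))) \<and>
     (AE \<omega> in completion W. continuous_on {0..} (\<lambda>t. Y t \<omega>)) \<and>
     (\<exists>I. (\<forall>i j. has_ito_integral W j (\<lambda>s \<omega>. \<sigma> (Y s \<omega>) $ i $ j) (I i j)) \<and>
        (AE \<omega> in completion W. \<forall>t\<ge>0. \<forall>i.
           Y t \<omega> $ i = x $ i + (\<Sum>j\<in>UNIV. I i j t \<omega>) + (LINT s:{0..t}|lborel. b (Y s \<omega>) $ i)))"

definition smooth_bounded_derivs :: "(real^'d::finite \<Rightarrow> real) \<Rightarrow> bool" where
  "smooth_bounded_derivs f \<longleftrightarrow>
     smooth f \<and> (\<forall>\<alpha>. 1 \<le> midx_len \<alpha> \<longrightarrow> bounded (range (mpartial \<alpha> f)))"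

text \<open>The modification of the family of solutions that is a stochastic flow of diffeomorphisms:
  off the null set \<open>N\<^sub>0\<close> every \<open>X(t, \<cdot>)\<close> is a \<open>C\<^sup>\<infinity>\<close> diffeomorphism, and the flow starts at
  the identity and is jointly continuous in time and space.\<close>

definition diffeo_flow ::
    "'r::finite path measure \<Rightarrow> (real^'d \<Rightarrow> real^'r^'d) \<Rightarrow> (real^'d \<Rightarrow> real^'d) \<Rightarrow>
     (real \<Rightarrow> real^'d::finite \<Rightarrow> 'r path \<Rightarrow> real^'d) \<Rightarrow> 'r path set \<Rightarrow> bool" where
  "diffeo_flow W \<sigma> b X N\<^sub>0 \<longleftrightarrow>
     (\<forall>x. sde_solution W \<sigma> b x (\<lambda>t. X t x)) \<and>
     N\<^sub>0 \<in> null_sets (completion W) \<and>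
     (\<forall>\<omega>\<in>space W - N\<^sub>0.
        (\<forall>x. X 0 x \<omega> = x) \<and>
        continuous_on ({0..} \<times> UNIV) (\<lambda>(t, x). X t x \<omega>) \<and>
        (\<forall>t\<ge>0. smooth_diffeo (\<lambda>x. X t x \<omega>)))"


section \<open>Processes with values in \<open>\<E>'\<close>\<close>

definition dual_process :: "'a measure \<Rightarrow> (real \<Rightarrow> 'a \<Rightarrow> 'd::finite functional) \<Rightarrow> bool" where
  "dual_process M Y \<longleftrightarrow> (\<forall>t\<ge>0. (\<forall>\<omega>\<in>space M. compact_distribution (Y t \<omega>)) \<and>
     (\<forall>\<phi>. smooth \<phi> \<longrightarrow> (\<lambda>\<omega>. Y t \<omega> \<phi>) \<in> borel_measurable M))"

definition locally_compact_support ::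
    "'r::finite path measure \<Rightarrow> (real \<Rightarrow> 'r path \<Rightarrow> 'd::finite functional) \<Rightarrow> bool" where
  "locally_compact_support W Y \<longleftrightarrow> dual_process (completion W) Y \<and>
     (\<exists>\<tau> K. (\<forall>n. stopping_time (brownian_filtration W) (\<tau> n)) \<and>
        (\<forall>\<omega>\<in>space W. incseq (\<lambda>n. \<tau> n \<omega>) \<and> (\<lambda>n. \<tau> n \<omega>) \<longlonglongrightarrow> (\<top>::ennreal)) \<and>
        (\<forall>n::nat. compact (K n)) \<and> incseq K \<and>
        (\<forall>n. AE \<omega> in completion W. \<forall>t\<ge>0.
           dist_supp (Y (enn2real (min (ennreal t) (\<tau> n \<omega>))) \<omega>) \<subseteq> K n))"

text \<open>The integral over \<open>V\<close> of the distributions \<open>\<partial>\<^sup>\<gamma>\<delta>\<^bsub>X(t,x)\<^esub>\<close> is the weak one, taken after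
  pairing with \<open>\<phi>\<close>. The polynomials depend on \<open>\<alpha>\<close> as well, hence \<open>P \<alpha> \<gamma>\<close>.\<close>

definition Z_process ::
    "'r path set \<Rightarrow> nat \<Rightarrow> (real^'d) set \<Rightarrow> (('d \<Rightarrow> nat) \<Rightarrow> real^'d \<Rightarrow> real) \<Rightarrow>
     (('d \<Rightarrow> nat) \<Rightarrow> ('d \<Rightarrow> nat) \<Rightarrow> 'd cpoly) \<Rightarrow>
     (real \<Rightarrow> real^'d::finite \<Rightarrow> 'r::finite path \<Rightarrow> real^'d) \<Rightarrow>
     real \<Rightarrow> 'r path \<Rightarrow> 'd functional" where
  "Z_process N\<^sub>0 N V g P X t \<omega> = (\<lambda>\<phi>. if \<omega> \<in> N\<^sub>0 then 0 else
     (\<Sum>\<alpha> | midx_len \<alpha> \<le> N. (-1) ^ midx_len \<alpha> *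
       (\<Sum>\<gamma> | midx_len \<gamma> \<le> midx_len \<alpha>. (-1) ^ midx_len \<gamma> *
         (LINT x:V|lborel. g \<alpha> x * cpoly_eval (P \<alpha> \<gamma>) (jet (\<lambda>y. X t y \<omega>) x) *
            dist_deriv \<gamma> (dirac (X t x \<omega>)) \<phi>))))"

definition exit_time ::
    "(real \<Rightarrow> real^'d::finite \<Rightarrow> 'w \<Rightarrow> real^'d) \<Rightarrow> real \<Rightarrow> real \<Rightarrow> 'w \<Rightarrow> ennreal" where
  "exit_time X l R \<omega> = Inf (ennreal ` {t. 0 < t \<and>
     ennreal R \<le> (SUP s\<in>{0..t}. SUP x\<in>cball 0 l. ennreal (norm (X s x \<omega>)))})"

end

theory Submission
  imports Defs
begin

text \<open>
  Pairing \<open>Z\<^sub>t\<close> with \<open>\<phi>\<close> only involves derivatives of \<open>\<phi>\<close> at the points \<open>X(t, x)\<close>, \<open>x \<in> V\<close>. Hence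
  the support of \<open>Z\<^sub>t\<close> lies in every closed set containing \<open>X(t, V)\<close>; up to the exit time
  \<open>\<tau>\<^sub>R\<close> the ball of radius \<open>R\<close> is such a set, by continuity of the flow at \<open>t = \<tau>\<^sub>R\<close>. The exit times
  tend to infinity because the flow is bounded on the compact sets \<open>[0, T] \<times> cball 0 l\<close>. The
  localizing sequence consists of exit times with radius larger than \<open>l\<close>: these are strictly
  positive, so that \<open>{\<tau>\<^sub>R \<le> t}\<close> is the event that the flow leaves the open ball during \<open>[0, t]\<close>,
  which is decided by a countable dense set of times and starting points.
\<close>

section \<open>Smooth functions and functionals\<close>

lemma finite_midx_len_le: "finite {\<gamma> :: 'd::finite \<Rightarrow> nat. midx_len \<gamma> \<le> k}"
proof (rule finite_subset)
  show "{\<gamma> :: 'd \<Rightarrow> nat. midx_len \<gamma> \<le> k} \<subseteq> PiE UNIV (\<lambda>_. {..k})"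
  proof safe
    fix \<gamma> :: "'d \<Rightarrow> nat" and i
    assume "midx_len \<gamma> \<le> k"
    moreover have "\<gamma> i \<le> midx_len \<gamma>"
      unfolding midx_len_def by (rule member_le_sum) auto
    ultimately show "\<gamma> i \<le> k" by simp
  qed auto
  show "finite (PiE (UNIV :: 'd set) (\<lambda>_. {..k}))"
    by (intro finite_PiE) auto
qed

lemma smooth_partials_DERIV:
  assumes "smooth f"
  shows "((\<lambda>h. partials is f (x + h *\<^sub>R axis i 1)) has_real_derivative partials (i # is) f x) (at 0)"
  using assms unfolding smooth_def partials.simps partial_def
  by (simp add: DERIV_deriv_iff_real_differentiable)

lemma smooth_mpartial_continuous: "smooth f \<Longrightarrow> continuous_on UNIV (mpartial \<alpha> f)"
  by (simp add: smooth_def mpartial_def)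

lemma partials_lincomb:
  assumes "smooth f" "smooth g"
  shows "partials is (\<lambda>x. a * f x + c * g x) x = a * partials is f x + c * partials is g x"
proof (induction "is" arbitrary: x)
  case (Cons i "is")
  have "((\<lambda>h. a * partials is f (x + h *\<^sub>R axis i 1) + c * partials is g (x + h *\<^sub>R axis i 1))
      has_real_derivative a * partials (i # is) f x + c * partials (i # is) g x) (at 0)"
    by (intro DERIV_add DERIV_cmult smooth_partials_DERIV assms)
  then show ?case
    by (simp add: partial_def[of i "partials is (\<lambda>x. a * f x + c * g x)"] Cons.IH DERIV_imp_deriv)
qed simp

lemma mpartial_lincomb:
  "smooth f \<Longrightarrow> smooth g \<Longrightarrow>
    mpartial \<alpha> (\<lambda>x. a * f x + c * g x) x = a * mpartial \<alpha> f x + c * mpartial \<alpha> g x"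
  unfolding mpartial_def by (rule partials_lincomb)

lemma partials_eq_0_on_open:
  assumes "open U" "\<And>x. x \<in> U \<Longrightarrow> f x = 0" "x \<in> U"
  shows "partials is f x = 0"
  using assms(3)
proof (induction "is" arbitrary: x)
  case (Cons i "is")
  define p where "p h = x + h *\<^sub>R axis i (1::real)" for h :: real
  have "(p \<longlongrightarrow> p 0) (at 0)"
    unfolding p_def by (intro tendsto_intros)
  then have "((\<lambda>h. x + h *\<^sub>R axis i (1::real)) \<longlongrightarrow> x) (nhds (0::real))"
    unfolding tendsto_at_iff_tendsto_nhds by (simp add: p_def[abs_def])
  then have "eventually (\<lambda>h. x + h *\<^sub>R axis i 1 \<in> U) (nhds (0::real))"
    using assms(1) Cons.prems by (rule topological_tendstoD)
  then have "eventually (\<lambda>h. partials is f (x + h *\<^sub>R axis i 1) = 0) (nhds 0)"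
    by eventually_elim (rule Cons.IH)
  then have "deriv (\<lambda>h. partials is f (x + h *\<^sub>R axis i 1)) 0 = deriv (\<lambda>_. 0) 0"
    by (intro deriv_cong_ev) auto
  then show ?case by (simp add: partial_def)
qed (simp add: assms(2))

lemma mpartial_eq_0_outside_supp:
  assumes "x \<notin> fun_supp \<phi>"
  shows "mpartial \<alpha> \<phi> x = 0"
  unfolding mpartial_def
proof (rule partials_eq_0_on_open[of "- fun_supp \<phi>"])
  show "\<phi> y = 0" if "y \<in> - fun_supp \<phi>" for y
    using that closure_subset[of "{x. \<phi> x \<noteq> 0}"] unfolding fun_supp_def by blast
qed (use assms in \<open>auto simp: fun_supp_def\<close>)

lemma continuous_on_cpoly_eval:
  assumes "\<And>v. continuous_on A (\<lambda>x. a x v)"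
  shows "continuous_on A (\<lambda>x. cpoly_eval p (a x))"
  unfolding cpoly_eval_def by (intro continuous_intros assms)

lemma borel_measurable_cpoly_eval:
  assumes "\<And>v. (\<lambda>x. a x v) \<in> borel_measurable M"
  shows "(\<lambda>x. cpoly_eval p (a x)) \<in> borel_measurable M"
  unfolding cpoly_eval_def
  by (intro borel_measurable_sum borel_measurable_times borel_measurable_prod
      borel_measurable_power borel_measurable_const assms)

lemma continuous_on_jet:
  assumes "smooth_map f"
  shows "continuous_on UNIV (\<lambda>x. jet f x v)"
  using assms by (cases v) (auto simp: jet_def smooth_map_def intro: smooth_mpartial_continuous)

lemma smooth_continuous: "smooth f \<Longrightarrow> continuous_on UNIV f"
  unfolding smooth_def by (metis partials.simps(1))

lemma smooth_map_continuous:
  assumes "smooth_map f"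
  shows "continuous_on UNIV f"
proof -
  have "continuous_on UNIV (\<lambda>x. \<chi> i. f x $ i)"
    using assms by (intro continuous_on_vec_lambda) (auto simp: smooth_map_def smooth_continuous)
  then show ?thesis by simp
qed

lemma smooth_map_ident: "smooth_map (\<lambda>x :: real^'d::finite. x)"
  unfolding smooth_map_def
proof
  fix i :: 'd
  have D: "((\<lambda>h. a * (x + h *\<^sub>R axis j 1) $ i + c) has_real_derivative a * axis j 1 $ i) (at 0)"
    for a c :: real and j :: 'd and x :: "real^'d"
    by (auto intro!: derivative_eq_intros)
  have affine: "\<exists>a c. partials is (\<lambda>x. x $ i) = (\<lambda>x. a * x $ i + c)" for "is" :: "'d list"
  proof (induction "is")
    case Nil
    show ?case by (rule exI[of _ 1], rule exI[of _ 0]) simp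
  next
    case (Cons j "is")
    then obtain a c where ac: "partials is (\<lambda>x. x $ i) = (\<lambda>x. a * x $ i + c)" by blast
    have "partials (j # is) (\<lambda>x. x $ i) = (\<lambda>x. 0 * x $ i + a * axis j 1 $ i)"
      unfolding partials.simps ac partial_def DERIV_imp_deriv[OF D] by simp
    then show ?case by blast
  qed
  show "smooth (\<lambda>x :: real^'d. x $ i)"
    unfolding smooth_def
  proof
    fix "is" :: "'d list"
    obtain a c where ac: "partials is (\<lambda>x. x $ i) = (\<lambda>x. a * x $ i + c)"
      using affine by blast
    show "continuous_on UNIV (partials is (\<lambda>x. x $ i)) \<and>
        (\<forall>j x. (\<lambda>h. partials is (\<lambda>x. x $ i) (x + h *\<^sub>R axis j 1)) differentiable at 0)"
      unfolding ac
    proof (intro conjI allI)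
      show "(\<lambda>h. a * (x + h *\<^sub>R axis j 1) $ i + c) differentiable at 0" for j :: 'd and x
        using D real_differentiable_def by blast
    qed (intro continuous_intros)
  qed
qed

lemma set_integrable_continuous_bounded:
  fixes h :: "'a::euclidean_space \<Rightarrow> real"
  assumes "continuous_on UNIV h" "open V" "V \<subseteq> cball 0 l"
  shows "set_integrable lborel V h"
proof (rule set_integrable_subset)
  show "set_integrable lborel (cball 0 l) h"
    unfolding set_integrable_def
    by (intro borel_integrable_compact continuous_on_subset[OF assms(1)]) auto
qed (use assms in auto)

lemma linear_functional_on_sum:
  assumes "\<And>i. i \<in> I \<Longrightarrow> linear_functional_on D (T i)"
  shows "linear_functional_on D (\<lambda>\<phi>. \<Sum>i\<in>I. T i \<phi>)"
proof -
  have "(\<Sum>i\<in>I. T i (\<lambda>x. a * \<phi> x + c * \<eta> x)) = (\<Sum>i\<in>I. a * T i \<phi> + c * T i \<eta>)"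
    if "\<phi> \<in> D" "\<eta> \<in> D" for \<phi> \<eta> a c
    by (intro sum.cong refl) (use assms that in \<open>auto simp: linear_functional_on_def\<close>)
  then show ?thesis
    by (simp add: linear_functional_on_def sum.distrib sum_distrib_left)
qed

lemma linear_functional_on_cmult:
  "linear_functional_on D T \<Longrightarrow> linear_functional_on D (\<lambda>\<phi>. b * T \<phi>)"
  by (simp add: linear_functional_on_def algebra_simps)

lemma seminorm_bound_sum:
  assumes "\<And>i. i \<in> I \<Longrightarrow> \<exists>C. seminorm_bound D K k C (T i)"
  shows "\<exists>C. seminorm_bound D K k C (\<lambda>\<phi>. \<Sum>i\<in>I. T i \<phi>)"
proof -
  obtain C where C: "\<And>i. i \<in> I \<Longrightarrow> seminorm_bound D K k (C i) (T i)"
    using assms by metis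
  have "\<bar>\<Sum>i\<in>I. T i \<phi>\<bar> \<le> (\<Sum>i\<in>I. C i) * (\<Sum>\<alpha> | midx_len \<alpha> \<le> k. SUP x\<in>K. \<bar>mpartial \<alpha> \<phi> x\<bar>)"
    if "\<phi> \<in> D" for \<phi>
    unfolding sum_distrib_right
    by (rule order_trans[OF sum_abs], rule sum_mono)
       (use C that in \<open>auto simp: seminorm_bound_def\<close>)
  then show ?thesis unfolding seminorm_bound_def by blast
qed

lemma seminorm_bound_cmult:
  assumes "\<exists>C. seminorm_bound D K k C T"
  shows "\<exists>C. seminorm_bound D K k C (\<lambda>\<phi>. b * T \<phi>)"
proof -
  obtain C where C: "seminorm_bound D K k C T" using assms by blast
  have "seminorm_bound D K k (\<bar>b\<bar> * C) (\<lambda>\<phi>. b * T \<phi>)"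
    using C unfolding seminorm_bound_def
    by (auto simp: abs_mult mult.assoc intro!: mult_left_mono)
  then show ?thesis by blast
qed

lemma linear_functional_on_integral:
  assumes "continuous_on UNIV h" "continuous_on UNIV F" "open V" "V \<subseteq> cball 0 l"
  shows "linear_functional_on {\<phi>. smooth \<phi>} (\<lambda>\<phi>. LINT x:V|lborel. h x * mpartial \<gamma> \<phi> (F x))"
proof -
  have int: "set_integrable lborel V (\<lambda>x. h x * mpartial \<gamma> \<phi> (F x))" if "smooth \<phi>" for \<phi>
    using that assms
    by (intro set_integrable_continuous_bounded continuous_intros
        continuous_on_compose2[OF smooth_mpartial_continuous]) auto
  have "(LINT x:V|lborel. h x * mpartial \<gamma> (\<lambda>x. a * \<phi> x + c * \<eta> x) (F x)) =
      a * (LINT x:V|lborel. h x * mpartial \<gamma> \<phi> (F x)) + c * (LINT x:V|lborel. h x * mpartial \<gamma> \<eta> (F x))"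
    if "smooth \<phi>" "smooth \<eta>" for \<phi> \<eta> a c
  proof -
    have "(LINT x:V|lborel. h x * mpartial \<gamma> (\<lambda>x. a * \<phi> x + c * \<eta> x) (F x)) =
      (LINT x:V|lborel. a * (h x * mpartial \<gamma> \<phi> (F x)) + c * (h x * mpartial \<gamma> \<eta> (F x)))"
      by (simp add: mpartial_lincomb[OF that] algebra_simps)
    also have "\<dots> = a * (LINT x:V|lborel. h x * mpartial \<gamma> \<phi> (F x)) +
        c * (LINT x:V|lborel. h x * mpartial \<gamma> \<eta> (F x))"
      using int[OF that(1)] int[OF that(2)] by (subst set_integral_add) auto
    finally show ?thesis .
  qed
  then show ?thesis by (simp add: linear_functional_on_def)
qed

lemma seminorm_bound_integral:
  assumes "continuous_on UNIV h" "continuous_on UNIV F" "open V" "V \<subseteq> cball 0 l"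
    and "midx_len \<gamma> \<le> k"
  shows "\<exists>C. seminorm_bound {\<phi>. smooth \<phi>} (F ` cball 0 l) k C
    (\<lambda>\<phi>. LINT x:V|lborel. h x * mpartial \<gamma> \<phi> (F x))"
proof -
  define C where "C = (LINT x:V|lborel. \<bar>h x\<bar>)"
  have "\<bar>LINT x:V|lborel. h x * mpartial \<gamma> \<phi> (F x)\<bar> \<le>
      C * (\<Sum>\<alpha> | midx_len \<alpha> \<le> k. SUP y\<in>F ` cball 0 l. \<bar>mpartial \<alpha> \<phi> y\<bar>)" if "smooth \<phi>" for \<phi>
  proof (cases "V = {}")
    case False
    define s where "s \<alpha> = (SUP y\<in>F ` cball 0 l. \<bar>mpartial \<alpha> \<phi> y\<bar>)" for \<alpha>
    have int: "set_integrable lborel V (\<lambda>x. h x * mpartial \<gamma> \<phi> (F x))"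
      using that assms
      by (intro set_integrable_continuous_bounded continuous_intros
          continuous_on_compose2[OF smooth_mpartial_continuous]) auto
    have inth: "set_integrable lborel V (\<lambda>x. \<bar>h x\<bar>)"
      using assms by (intro set_integrable_continuous_bounded continuous_intros) auto
    have s: "\<bar>mpartial \<alpha> \<phi> (F x)\<bar> \<le> s \<alpha>" if x: "x \<in> cball 0 l" for x \<alpha>
      unfolding s_def
    proof (rule cSUP_upper)
      have "compact ((\<lambda>y. \<bar>mpartial \<alpha> \<phi> y\<bar>) ` F ` cball 0 l)"
        using assms \<open>smooth \<phi>\<close>
        by (intro compact_continuous_image continuous_intros
            continuous_on_subset[OF smooth_mpartial_continuous] continuous_on_subset[OF assms(2)]) auto
      then show "bdd_above ((\<lambda>y. \<bar>mpartial \<alpha> \<phi> y\<bar>) ` F ` cball 0 l)"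
        by (rule bounded_imp_bdd_above[OF compact_imp_bounded])
    qed (use x in auto)
    have s0: "0 \<le> s \<alpha>" for \<alpha>
      using s[of _ \<alpha>] False assms(4) abs_ge_zero order_trans by blast
    have "\<bar>LINT x:V|lborel. h x * mpartial \<gamma> \<phi> (F x)\<bar> \<le> (LINT x:V|lborel. \<bar>h x * mpartial \<gamma> \<phi> (F x)\<bar>)"
      using set_integral_norm_bound[OF int] by simp
    also have "\<dots> \<le> (LINT x:V|lborel. \<bar>h x\<bar> * s \<gamma>)"
    proof (rule set_integral_mono)
      show "set_integrable lborel V (\<lambda>x. \<bar>h x * mpartial \<gamma> \<phi> (F x)\<bar>)"
        using set_integrable_norm[OF int] by simp
      show "set_integrable lborel V (\<lambda>x. \<bar>h x\<bar> * s \<gamma>)"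
        using inth by simp
      show "\<bar>h x * mpartial \<gamma> \<phi> (F x)\<bar> \<le> \<bar>h x\<bar> * s \<gamma>" if "x \<in> V" for x
        unfolding abs_mult using s[of x \<gamma>] that assms(4) by (intro mult_left_mono) auto
    qed
    also have "\<dots> = C * s \<gamma>" by (simp add: C_def)
    also have "\<dots> \<le> C * (\<Sum>\<alpha> | midx_len \<alpha> \<le> k. s \<alpha>)"
    proof (rule mult_left_mono)
      show "s \<gamma> \<le> (\<Sum>\<alpha> | midx_len \<alpha> \<le> k. s \<alpha>)"
        using assms(5) s0 finite_midx_len_le[of k] by (intro member_le_sum) auto
      show "0 \<le> C" unfolding C_def set_lebesgue_integral_def by (rule Bochner_Integration.integral_nonneg) auto
    qed
    finally show ?thesis unfolding s_def .
  qed (simp add: C_def set_lebesgue_integral_def)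
  then show ?thesis unfolding seminorm_bound_def by blast
qed

section \<open>The distributions \<open>Z\<^sub>t\<close>\<close>

lemma Z_process_eq:
  fixes V :: "(real^'d::finite) set"
  shows "Z_process N\<^sub>0 N V g P X t \<omega> \<phi> = (if \<omega> \<in> N\<^sub>0 then 0 else
     (\<Sum>\<alpha> | midx_len \<alpha> \<le> N. (-1) ^ midx_len \<alpha> *
       (\<Sum>\<gamma> | midx_len \<gamma> \<le> midx_len \<alpha>.
         (LINT x:V|lborel. (g \<alpha> x * cpoly_eval (P \<alpha> \<gamma>) (jet (\<lambda>y. X t y \<omega>) x)) *
            mpartial \<gamma> \<phi> (X t x \<omega>)))))"
proof -
  have "(-1) ^ n * (LINT x:V|lborel. a x * ((-1) ^ n * u x)) = (LINT x:V|lborel. a x * u x)"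
    for n and a u :: "real^'d \<Rightarrow> real"
    by (cases "even n") (simp_all add: set_lebesgue_integral_def)
  then show ?thesis unfolding Z_process_def dist_deriv_def dirac_def by simp
qed

lemma compact_distribution_Z_process:
  assumes "\<omega> \<notin> N\<^sub>0 \<Longrightarrow> smooth_map (\<lambda>x. X t x \<omega>)"
    and "\<And>\<alpha>. midx_len \<alpha> \<le> N \<Longrightarrow> continuous_on UNIV (g \<alpha>)"
    and "open V" "V \<subseteq> cball 0 l" "0 \<le> l"
  shows "compact_distribution (Z_process N\<^sub>0 N V g P X t \<omega>)"
proof (cases "\<omega> \<in> N\<^sub>0")
  case True
  have "seminorm_bound {\<phi>. smooth \<phi>} {0} 0 0 (Z_process N\<^sub>0 N V g P X t \<omega>)"
    and "linear_functional_on {\<phi>. smooth \<phi>} (Z_process N\<^sub>0 N V g P X t \<omega>)"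
    by (auto simp: seminorm_bound_def linear_functional_on_def Z_process_def True)
  then show ?thesis unfolding compact_distribution_def
    by (metis compact_sing insert_not_empty)
next
  case False
  let ?F = "\<lambda>x. X t x \<omega>"
  have F: "continuous_on UNIV ?F"
    using smooth_map_continuous assms(1) False by blast
  have h: "continuous_on UNIV (\<lambda>x. g \<alpha> x * cpoly_eval (P \<alpha> \<gamma>) (jet ?F x))"
    if "midx_len \<alpha> \<le> N" for \<alpha> \<gamma>
    using assms(1)[OF False] that
    by (intro continuous_intros continuous_on_cpoly_eval continuous_on_jet assms(2))
  have Z: "Z_process N\<^sub>0 N V g P X t \<omega> =
     (\<lambda>\<phi>. \<Sum>\<alpha> | midx_len \<alpha> \<le> N. (-1) ^ midx_len \<alpha> *
       (\<Sum>\<gamma> | midx_len \<gamma> \<le> midx_len \<alpha>.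
         (LINT x:V|lborel. (g \<alpha> x * cpoly_eval (P \<alpha> \<gamma>) (jet ?F x)) * mpartial \<gamma> \<phi> (?F x))))"
    by (rule ext) (simp add: Z_process_eq False)
  have lin: "linear_functional_on {\<phi>. smooth \<phi>} (Z_process N\<^sub>0 N V g P X t \<omega>)"
    unfolding Z
    by (intro linear_functional_on_sum linear_functional_on_cmult
        linear_functional_on_integral[OF _ F assms(3,4)]) (auto intro: h)
  have "\<exists>C. seminorm_bound {\<phi>. smooth \<phi>} (?F ` cball 0 l) N C (Z_process N\<^sub>0 N V g P X t \<omega>)"
    unfolding Z
    by (intro seminorm_bound_sum seminorm_bound_cmult
        seminorm_bound_integral[OF _ F assms(3,4)]) (auto intro: h)
  moreover have "compact (?F ` cball 0 l)"
    by (intro compact_continuous_image continuous_on_subset[OF F]) auto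
  moreover have "?F ` cball 0 l \<noteq> {}" using assms(5) by auto
  ultimately show ?thesis using lin unfolding compact_distribution_def by blast
qed

lemma dist_supp_Z_process_subset:
  assumes "\<And>x. \<omega> \<notin> N\<^sub>0 \<Longrightarrow> x \<in> V \<Longrightarrow> X t x \<omega> \<in> S" "closed S"
  shows "dist_supp (Z_process N\<^sub>0 N V g P X t \<omega>) \<subseteq> S"
proof -
  have "Z_process N\<^sub>0 N V g P X t \<omega> \<phi> = 0" if "fun_supp \<phi> \<subseteq> - S" for \<phi>
  proof (cases "\<omega> \<in> N\<^sub>0")
    case False
    have "mpartial \<gamma> \<phi> (X t x \<omega>) = 0" if "x \<in> V" for x \<gamma>
      using assms(1)[OF False that] \<open>fun_supp \<phi> \<subseteq> - S\<close> by (intro mpartial_eq_0_outside_supp) auto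
    then have "(\<lambda>x. indicator V x *\<^sub>R (a x * mpartial \<gamma> \<phi> (X t x \<omega>))) = (\<lambda>_. 0)" for a \<gamma>
      by (auto simp: indicator_def fun_eq_iff)
    then have "(LINT x:V|lborel. a x * mpartial \<gamma> \<phi> (X t x \<omega>)) = 0" for a \<gamma>
      unfolding set_lebesgue_integral_def by simp
    then show ?thesis by (simp add: Z_process_eq)
  qed (simp add: Z_process_eq)
  then show ?thesis
    using assms(2) unfolding dist_supp_def by (auto simp: open_Compl)
qed

lemma borel_measurable_partials:
  assumes "\<And>\<omega>. \<omega> \<in> space M \<Longrightarrow> smooth (\<lambda>x. F x \<omega>)"
    and "\<And>x. F x \<in> borel_measurable M"
  shows "(\<lambda>\<omega>. partials is (\<lambda>x. F x \<omega>) x) \<in> borel_measurable M"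
proof (induction "is" arbitrary: x)
  case (Cons i "is")
  define h where "h n = inverse (real (Suc n))" for n
  have h: "filterlim h (at 0) sequentially"
    unfolding h_def filterlim_at using LIMSEQ_inverse_real_of_nat by auto
  have D: "((\<lambda>h. (partials is (\<lambda>x. F x \<omega>) (x + h *\<^sub>R axis i 1) - partials is (\<lambda>x. F x \<omega>) x) / h)
      \<longlongrightarrow> partials (i # is) (\<lambda>x. F x \<omega>) x) (at 0)" if "\<omega> \<in> space M" for \<omega>
    using smooth_partials_DERIV[OF assms(1)[OF that], of "is" x i] by (simp add: DERIV_def)
  have lim: "(\<lambda>n. (partials is (\<lambda>x. F x \<omega>) (x + h n *\<^sub>R axis i 1) - partials is (\<lambda>x. F x \<omega>) x) / h n)
      \<longlonglongrightarrow> partials (i # is) (\<lambda>x. F x \<omega>) x" if "\<omega> \<in> space M" for \<omega>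
    by (rule filterlim_compose[OF D[OF that] h])
  show ?case
    by (rule borel_measurable_LIMSEQ_real[OF lim], assumption)
       (intro borel_measurable_divide borel_measurable_diff borel_measurable_const Cons.IH)
qed (simp add: assms(2))

lemma borel_measurable_Caratheodory:
  fixes f :: "'a::{metric_space, second_countable_topology} \<Rightarrow> 'w \<Rightarrow> real"
  assumes "\<And>\<omega>. \<omega> \<in> space M \<Longrightarrow> continuous_on UNIV (\<lambda>x. f x \<omega>)"
    and "\<And>x. f x \<in> borel_measurable M"
  shows "(\<lambda>(\<omega>, x). f x \<omega>) \<in> borel_measurable (M \<Otimes>\<^sub>M borel)"
proof -
  obtain s :: "nat \<Rightarrow> 'a \<Rightarrow> 'a" where s: "\<And>n. simple_function borel (s n)" "\<And>x. (\<lambda>n. s n x) \<longlonglongrightarrow> x"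
    using borel_measurable_implies_sequence_metric[of "\<lambda>x::'a. x" borel undefined] by auto
  have "(\<lambda>p. f (s n (snd p)) (fst p)) \<in> borel_measurable (M \<Otimes>\<^sub>M borel)" for n
  proof (rule measurable_compose_countable'[where I = "range (s n)" and f = "\<lambda>i p. f i (fst p)"])
    have "s n \<in> measurable borel (count_space (range (s n)))"
      using s(1)[of n] by (simp add: measurable_count_space_eq2 simple_function_def vimage_def)
    then show "(\<lambda>p. s n (snd p)) \<in> measurable (M \<Otimes>\<^sub>M borel) (count_space (range (s n)))"
      by (rule measurable_compose[OF measurable_snd])
    show "countable (range (s n))"
      using simple_functionD(1)[OF s(1)[of n]] by (simp add: countable_finite)
    show "(\<lambda>p. f i (fst p)) \<in> borel_measurable (M \<Otimes>\<^sub>M borel)" for i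
      by (rule measurable_compose[OF measurable_fst assms(2)])
  qed
  then have "(\<lambda>p. f (snd p) (fst p)) \<in> borel_measurable (M \<Otimes>\<^sub>M borel)"
  proof (rule borel_measurable_LIMSEQ_real[rotated])
    show "(\<lambda>n. f (s n (snd p)) (fst p)) \<longlonglongrightarrow> f (snd p) (fst p)"
      if "p \<in> space (M \<Otimes>\<^sub>M borel)" for p
      using that
      by (intro continuous_on_tendsto_compose[OF assms(1)] s(2)) (auto simp: space_pair_measure)
  qed
  then show ?thesis by (simp add: case_prod_unfold)
qed

lemma borel_measurable_Z_process:
  assumes Y: "\<And>\<omega>. \<omega> \<in> space M \<Longrightarrow> smooth_map (\<lambda>x. Y x \<omega>)" "\<And>x. Y x \<in> borel_measurable M"
    and g: "\<And>\<alpha>. midx_len \<alpha> \<le> N \<Longrightarrow> continuous_on UNIV (g \<alpha>)"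
    and "open V" "N\<^sub>0 \<in> sets M" "smooth \<phi>"
    and XY: "\<And>x \<omega>. \<omega> \<in> space M - N\<^sub>0 \<Longrightarrow> X t x \<omega> = Y x \<omega>"
  shows "(\<lambda>\<omega>. Z_process N\<^sub>0 N V g P X t \<omega> \<phi>) \<in> borel_measurable M"
proof -
  have jetm: "(\<lambda>\<omega>. jet (\<lambda>y. Y y \<omega>) x v) \<in> borel_measurable M" for x v
  proof (cases v)
    case (Pair i \<beta>)
    have "(\<lambda>\<omega>. Y y \<omega> $ i) \<in> borel_measurable M" for y
      by (rule measurable_compose[OF Y(2)], rule borel_measurable_continuous_onI)
         (intro continuous_intros)
    then show ?thesis
      using Y(1) unfolding Pair jet_def mpartial_def smooth_map_def
      by (auto intro!: borel_measurable_partials[where F = "\<lambda>y \<omega>. Y y \<omega> $ i"])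
  qed
  have int: "(\<lambda>\<omega>. LINT x:V|lborel. (g \<alpha> x * cpoly_eval (P \<alpha> \<gamma>) (jet (\<lambda>y. Y y \<omega>) x)) *
            mpartial \<gamma> \<phi> (Y x \<omega>)) \<in> borel_measurable M" if "midx_len \<alpha> \<le> N" for \<alpha> \<gamma>
  proof -
    let ?f = "\<lambda>x \<omega>. (g \<alpha> x * cpoly_eval (P \<alpha> \<gamma>) (jet (\<lambda>y. Y y \<omega>) x)) * mpartial \<gamma> \<phi> (Y x \<omega>)"
    have "(\<lambda>(\<omega>, x). ?f x \<omega>) \<in> borel_measurable (M \<Otimes>\<^sub>M borel)"
    proof (rule borel_measurable_Caratheodory)
      show "continuous_on UNIV (\<lambda>x. ?f x \<omega>)" if "\<omega> \<in> space M" for \<omega>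
        using Y(1)[OF that] \<open>midx_len \<alpha> \<le> N\<close> \<open>smooth \<phi>\<close>
        by (intro continuous_intros continuous_on_cpoly_eval continuous_on_jet g
            continuous_on_compose2[OF smooth_mpartial_continuous] smooth_map_continuous) auto
      have "mpartial \<gamma> \<phi> \<in> borel_measurable borel"
        by (intro borel_measurable_continuous_onI smooth_mpartial_continuous assms)
      then show "?f x \<in> borel_measurable M" for x
        by (intro borel_measurable_times borel_measurable_const borel_measurable_cpoly_eval jetm
            measurable_compose[OF Y(2)])
    qed
    then have f: "(\<lambda>p. ?f (snd p) (fst p)) \<in> borel_measurable (M \<Otimes>\<^sub>M lborel)"
      by (simp add: case_prod_unfold)
    have "V \<in> sets lborel" using \<open>open V\<close> by simp
    then have "(\<lambda>p. indicator V (snd p) :: real) \<in> borel_measurable (M \<Otimes>\<^sub>M lborel)"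
      by (intro measurable_compose[OF measurable_snd borel_measurable_indicator])
    from borel_measurable_scaleR[OF this f]
    have "(\<lambda>(\<omega>, x). indicator V x *\<^sub>R ?f x \<omega>) \<in> borel_measurable (M \<Otimes>\<^sub>M lborel)"
      by (simp only: case_prod_unfold)
    then show ?thesis
      unfolding set_lebesgue_integral_def
      by (rule lborel.borel_measurable_lebesgue_integral)
  qed
  have *: "(\<lambda>\<omega>. if \<omega> \<in> N\<^sub>0 then 0 else \<Sum>\<alpha> | midx_len \<alpha> \<le> N. (-1) ^ midx_len \<alpha> *
       (\<Sum>\<gamma> | midx_len \<gamma> \<le> midx_len \<alpha>.
         (LINT x:V|lborel. (g \<alpha> x * cpoly_eval (P \<alpha> \<gamma>) (jet (\<lambda>y. Y y \<omega>) x)) *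
            mpartial \<gamma> \<phi> (Y x \<omega>)))) \<in> borel_measurable M"
    by (intro measurable_If_set borel_measurable_sum borel_measurable_times borel_measurable_const int)
       (use \<open>N\<^sub>0 \<in> sets M\<close> in auto)
  show ?thesis
  proof (rule measurable_cong[THEN iffD1, OF _ *])
    fix \<omega>
    assume "\<omega> \<in> space M"
    show "(if \<omega> \<in> N\<^sub>0 then 0 else \<Sum>\<alpha> | midx_len \<alpha> \<le> N. (-1) ^ midx_len \<alpha> *
       (\<Sum>\<gamma> | midx_len \<gamma> \<le> midx_len \<alpha>.
         (LINT x:V|lborel. (g \<alpha> x * cpoly_eval (P \<alpha> \<gamma>) (jet (\<lambda>y. Y y \<omega>) x)) *
            mpartial \<gamma> \<phi> (Y x \<omega>)))) = Z_process N\<^sub>0 N V g P X t \<omega> \<phi>"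
    proof (cases "\<omega> \<in> N\<^sub>0")
      case False
      then have "Y x \<omega> = X t x \<omega>" for x using XY \<open>\<omega> \<in> space M\<close> by simp
      then show ?thesis unfolding Z_process_eq by (simp only:)
    qed (simp add: Z_process_eq)
  qed
qed

section \<open>Exit times\<close>

lemma exit_time_mono: "R \<le> R' \<Longrightarrow> exit_time X l R \<omega> \<le> exit_time X l R' \<omega>"
  unfolding exit_time_def
  by (intro Inf_superset_mono image_mono) (auto intro: order_trans[OF ennreal_leI])

lemma exit_time_leI:
  assumes "0 < s" "x \<in> cball 0 l" "R \<le> norm (X s x \<omega>)"
  shows "exit_time X l R \<omega> \<le> ennreal s"
  unfolding exit_time_def
proof (rule Inf_lower, rule imageI, safe)
  have "ennreal R \<le> ennreal (norm (X s x \<omega>))" by (rule ennreal_leI[OF assms(3)])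
  also have "\<dots> \<le> (SUP x\<in>cball 0 l. ennreal (norm (X s x \<omega>)))" by (rule SUP_upper[OF assms(2)])
  also have "\<dots> \<le> (SUP s\<in>{0..s}. SUP x\<in>cball 0 l. ennreal (norm (X s x \<omega>)))"
    using assms(1) by (intro SUP_upper) auto
  finally show "ennreal R \<le> (SUP s\<in>{0..s}. SUP x\<in>cball 0 l. ennreal (norm (X s x \<omega>)))" .
qed (rule assms(1))

lemma norm_le_of_le_exit_time:
  assumes cont: "continuous_on ({0..} \<times> UNIV) (\<lambda>(t, x). X t x \<omega>)"
    and t: "0 < t" "ennreal t \<le> exit_time X l R \<omega>" and x: "x \<in> cball 0 l"
  shows "norm (X t x \<omega>) \<le> R"
proof -
  have less: "norm (X s x \<omega>) \<le> R" if "s \<in> {0<..<t}" for s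
  proof (rule ccontr)
    assume "\<not> norm (X s x \<omega>) \<le> R"
    then have "exit_time X l R \<omega> \<le> ennreal s"
      using that x by (intro exit_time_leI) auto
    with t(2) have "ennreal t \<le> ennreal s" by (rule order_trans)
    then show False using that by (simp add: ennreal_le_iff)
  qed
  have "continuous_on {0..} (\<lambda>s. (\<lambda>p. X (fst p) (snd p) \<omega>) (s, x))"
    by (rule continuous_on_compose2[OF cont[unfolded case_prod_unfold]])
       (auto intro!: continuous_intros)
  then have "continuous_on {0..} (\<lambda>s. X s x \<omega>)" by simp
  then have "continuous_on (closure {0<..<t}) (\<lambda>s. norm (X s x \<omega>))"
    by (rule continuous_on_norm[OF continuous_on_subset]) (use t(1) in auto)
  then show ?thesis
    by (rule continuous_le_on_closure[OF _ _ less]) (use t(1) in auto)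
qed

lemma SUP_norm_attained:
  fixes X :: "real \<Rightarrow> real^'d::finite \<Rightarrow> 'w \<Rightarrow> real^'d"
  assumes cont: "continuous_on ({0..} \<times> UNIV) (\<lambda>(t, x). X t x \<omega>)"
    and "0 < R" "ennreal R \<le> (SUP s\<in>{0..t}. SUP x\<in>cball 0 l. ennreal (norm (X s x \<omega>)))"
  shows "\<exists>s\<in>{0..t}. \<exists>x\<in>cball 0 l. R \<le> norm (X s x \<omega>)"
proof -
  let ?A = "{0..t} \<times> (cball 0 l :: (real^'d) set)" and ?h = "\<lambda>p. norm (X (fst p) (snd p) \<omega>)"
  have S: "(SUP s\<in>{0..t}. SUP x\<in>cball 0 l. ennreal (norm (X s x \<omega>))) = (SUP p\<in>?A. ennreal (?h p))"
  proof (rule antisym)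
    show "(SUP s\<in>{0..t}. SUP x\<in>cball 0 l. ennreal (norm (X s x \<omega>))) \<le> (SUP p\<in>?A. ennreal (?h p))"
    proof (intro SUP_least)
      fix s and x :: "real^'d" assume "s \<in> {0..t}" "x \<in> cball 0 l"
      then show "ennreal (norm (X s x \<omega>)) \<le> (SUP p\<in>?A. ennreal (?h p))"
        using SUP_upper[of "(s, x)" ?A "\<lambda>p. ennreal (?h p)"] by simp
    qed
    show "(SUP p\<in>?A. ennreal (?h p)) \<le> (SUP s\<in>{0..t}. SUP x\<in>cball 0 l. ennreal (norm (X s x \<omega>)))"
    proof (rule SUP_least)
      fix p assume "p \<in> ?A"
      then show "ennreal (?h p) \<le> (SUP s\<in>{0..t}. SUP x\<in>cball 0 l. ennreal (norm (X s x \<omega>)))"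
        by (intro SUP_upper2[of "fst p"] SUP_upper) auto
    qed
  qed
  have ne: "?A \<noteq> {}"
  proof
    assume empty: "?A = {}"
    show False using assms(2,3) unfolding S empty by (simp add: bot_ennreal)
  qed
  have ch: "continuous_on ?A ?h"
    by (intro continuous_intros continuous_on_subset[OF cont[unfolded case_prod_unfold]]) auto
  have "compact ?A" by (intro compact_Times) auto
  from continuous_attains_sup[OF this ne ch]
  obtain p where p: "p \<in> ?A" "\<And>q. q \<in> ?A \<Longrightarrow> ?h q \<le> ?h p" by blast
  have "(SUP p\<in>?A. ennreal (?h p)) \<le> ennreal (?h p)"
    by (intro SUP_least ennreal_leI p)
  with assms(3) have "ennreal R \<le> ennreal (?h p)" unfolding S by (rule order_trans)
  then have "R \<le> ?h p" by (simp add: ennreal_le_iff)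
  then show ?thesis using p(1) by (intro bexI[of _ "fst p"] bexI[of _ "snd p"]) auto
qed

lemma le_exit_timeI:
  assumes cont: "continuous_on ({0..} \<times> UNIV) (\<lambda>(t, x). X t x \<omega>)"
    and "0 < R" "\<And>s x. 0 \<le> s \<Longrightarrow> s < u \<Longrightarrow> x \<in> cball 0 l \<Longrightarrow> norm (X s x \<omega>) < R"
  shows "ennreal u \<le> exit_time X l R \<omega>"
  unfolding exit_time_def
proof (rule Inf_greatest, safe)
  fix t :: real
  assume "0 < t" "ennreal R \<le> (SUP s\<in>{0..t}. SUP x\<in>cball 0 l. ennreal (norm (X s x \<omega>)))"
  then obtain s x where "s \<in> {0..t}" "x \<in> cball 0 l" "R \<le> norm (X s x \<omega>)"
    using SUP_norm_attained[where X = X and \<omega> = \<omega>, OF cont assms(2)] by blast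
  then have "u \<le> t" using assms(3)[of s x] by force
  then show "ennreal u \<le> ennreal t" by (rule ennreal_leI)
qed

lemma exit_time_le_iff:
  fixes X :: "real \<Rightarrow> real^'d::finite \<Rightarrow> 'w \<Rightarrow> real^'d"
  assumes cont: "continuous_on ({0..} \<times> UNIV) (\<lambda>(t, x). X t x \<omega>)"
    and X0: "\<And>x. X 0 x \<omega> = x" and R: "0 \<le> l" "l < R" and r: "0 \<le> r"
  shows "exit_time X l R \<omega> \<le> ennreal r \<longleftrightarrow> (\<exists>s\<in>{0..r}. \<exists>x\<in>cball 0 l. R \<le> norm (X s x \<omega>))"
proof
  assume "\<exists>s\<in>{0..r}. \<exists>x\<in>cball 0 l. R \<le> norm (X s x \<omega>)"
  then obtain s x where sx: "s \<in> {0..r}" "x \<in> cball 0 l" "R \<le> norm (X s x \<omega>)" by blast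
  then have "s \<noteq> 0" using X0[of x] R by auto
  then have "exit_time X l R \<omega> \<le> ennreal s"
    using sx by (intro exit_time_leI) auto
  also have "\<dots> \<le> ennreal r" using sx by (intro ennreal_leI) auto
  finally show "exit_time X l R \<omega> \<le> ennreal r" .
next
  assume le: "exit_time X l R \<omega> \<le> ennreal r"
  let ?A = "{0..r+1} \<times> (cball 0 l :: (real^'d) set)" and ?h = "\<lambda>p. norm (X (fst p) (snd p) \<omega>)"
  define H where "H = {p \<in> ?A. R \<le> ?h p}"
  have "continuous_on ?A ?h"
    by (intro continuous_intros continuous_on_subset[OF cont[unfolded case_prod_unfold]]) auto
  then have "closedin (top_of_set ?A) (?A \<inter> ?h -` {R..})"
    by (intro continuous_closedin_preimage) auto
  moreover have "?A \<inter> ?h -` {R..} = H" unfolding H_def by auto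
  moreover have "compact ?A" by (intro compact_Times) auto
  ultimately have "compact H" by (metis closedin_compact)
  have "H \<noteq> {}"
  proof
    assume "H = {}"
    then have "norm (X s x \<omega>) < R" if "0 \<le> s" "s < r + 1" "x \<in> cball 0 l" for s x
      using that unfolding H_def by force
    then have "ennreal (r + 1) \<le> exit_time X l R \<omega>"
      using R by (intro le_exit_timeI[where X = X and \<omega> = \<omega>, OF cont]) auto
    with le have "ennreal (r + 1) \<le> ennreal r" by (rule order_trans[rotated])
    then show False using r by (simp add: ennreal_le_iff)
  qed
  then obtain p where p: "p \<in> H" "\<And>q. q \<in> H \<Longrightarrow> fst p \<le> fst q"
    using continuous_attains_inf[OF \<open>compact H\<close> _ continuous_on_fst[OF continuous_on_id]] by blast
  have "norm (X s x \<omega>) < R" if "0 \<le> s" "s < fst p" "x \<in> cball 0 l" for s x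
    using that p(1) p(2)[of "(s, x)"] unfolding H_def by force
  then have "ennreal (fst p) \<le> exit_time X l R \<omega>"
    using R by (intro le_exit_timeI[where X = X and \<omega> = \<omega>, OF cont]) auto
  with le have "ennreal (fst p) \<le> ennreal r" by (rule order_trans[rotated])
  then have "fst p \<le> r" using r by (simp add: ennreal_le_iff)
  then show "\<exists>s\<in>{0..r}. \<exists>x\<in>cball 0 l. R \<le> norm (X s x \<omega>)"
    using p(1) unfolding H_def by (intro bexI[of _ "fst p"] bexI[of _ "snd p"]) auto
qed

lemma exit_time_tendsto_top:
  assumes cont: "continuous_on ({0..} \<times> UNIV) (\<lambda>(t, x). X t x \<omega>)"
  shows "((\<lambda>R. exit_time X l R \<omega>) \<longlongrightarrow> \<top>) at_top"
proof (rule order_tendstoI)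
  fix a :: ennreal
  assume "a < \<top>"
  then obtain r where r: "a = ennreal r" "0 \<le> r" by (cases a) auto
  let ?A = "{0..r+1} \<times> cball 0 l"
  have "compact ((\<lambda>(t, x). X t x \<omega>) ` ?A)"
    by (intro compact_continuous_image continuous_on_subset[OF cont] compact_Times) auto
  then obtain B where B: "\<And>y. y \<in> (\<lambda>(t, x). X t x \<omega>) ` ?A \<Longrightarrow> norm y \<le> B"
    using compact_imp_bounded bounded_iff by metis
  have "a < exit_time X l R \<omega>" if "max 0 B < R" for R
  proof -
    have "norm (X s x \<omega>) < R" if "0 \<le> s" "s < r + 1" "x \<in> cball 0 l" for s x
      using B[of "X s x \<omega>"] that \<open>max 0 B < R\<close> by force
    then have "ennreal (r + 1) \<le> exit_time X l R \<omega>"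
      using that by (intro le_exit_timeI[where X = X and \<omega> = \<omega>, OF cont]) auto
    moreover have "a < ennreal (r + 1)" using r by (simp add: ennreal_less_iff)
    ultimately show ?thesis by (rule less_le_trans[rotated])
  qed
  then show "eventually (\<lambda>R. a < exit_time X l R \<omega>) at_top"
    by (rule eventually_mono[OF eventually_gt_at_top])
qed simp

lemma space_brownian_filtration [simp]: "space (brownian_filtration W t) = space W"
  by (simp add: brownian_filtration_def space_measure_of_conv)

lemma brownian_filtration_generators:
  "{{\<omega> \<in> space W. \<omega> s \<in> A} | s A. 0 \<le> s \<and> ennreal s \<le> t \<and> A \<in> sets borel} \<union>
      null_sets (completion W) \<subseteq> Pow (space W)"
proof -
  have "null_sets (completion W) \<subseteq> Pow (space W)"
    using sets.sets_into_space[of _ "completion W"] by (auto simp: null_sets_def)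
  then show ?thesis by auto
qed

lemma sets_brownian_filtration_mono:
  assumes "s \<le> t"
  shows "sets (brownian_filtration W s) \<subseteq> sets (brownian_filtration W t)"
  unfolding brownian_filtration_def sets_measure_of[OF brownian_filtration_generators]
  by (rule sigma_sets_mono') (use assms in \<open>auto intro: order_trans\<close>)

lemma null_sets_brownian_filtration:
  "A \<in> null_sets (completion W) \<Longrightarrow> A \<in> sets (brownian_filtration W t)"
  unfolding brownian_filtration_def sets_measure_of[OF brownian_filtration_generators] by auto

lemma evaluation_measurable:
  fixes W :: "'r::finite path measure"
  assumes sets: "sets W = sigma_sets path_space {U. path_open U}" and space: "space W = path_space"
    and s: "0 \<le> s"
  shows "(\<lambda>\<omega>. \<omega> s) \<in> borel_measurable W"
proof (rule borel_measurableI)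
  fix S :: "(real^'r) set"
  assume "open S"
  have "path_open {\<omega> \<in> path_space. \<omega> s \<in> S}"
    unfolding path_open_def
  proof (safe)
    fix \<omega> :: "'r path" assume "\<omega> s \<in> S"
    then obtain e where e: "e > 0" "ball (\<omega> s) e \<subseteq> S"
      using \<open>open S\<close> open_contains_ball by blast
    show "\<exists>T\<ge>0. \<exists>e>0. \<forall>\<omega>'\<in>path_space. (\<forall>t\<in>{0..T}. dist (\<omega>' t) (\<omega> t) < e) \<longrightarrow>
        \<omega>' \<in> {\<omega> \<in> path_space. \<omega> s \<in> S}"
      using s e by (intro exI[of _ s] conjI exI[of _ e]) (auto simp: dist_commute subset_eq)
  qed
  then have "{\<omega> \<in> path_space. \<omega> s \<in> S} \<in> sets W" unfolding sets by (intro sigma_sets.Basic) auto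
  moreover have "(\<lambda>\<omega>. \<omega> s) -` S \<inter> space W = {\<omega> \<in> path_space. \<omega> s \<in> S}" using space by auto
  ultimately show "(\<lambda>\<omega>. \<omega> s) -` S \<inter> space W \<in> sets W" by simp
qed

lemma sets_brownian_filtration_completion:
  assumes "wiener_measure W"
  shows "sets (brownian_filtration W t) \<subseteq> sets (completion W)"
proof -
  have W: "sets W = sigma_sets path_space {U. path_open U}" "space W = path_space"
    using assms unfolding wiener_measure_def by auto
  have "{\<omega> \<in> space W. \<omega> s \<in> A} \<in> sets (completion W)" if "0 \<le> s" "A \<in> sets borel" for s A
    using measurable_sets[OF evaluation_measurable[OF W that(1)] that(2)]
    by (auto simp: vimage_def Int_def conj_commute)
  then have "{{\<omega> \<in> space W. \<omega> s \<in> A} | s A. 0 \<le> s \<and> ennreal s \<le> t \<and> A \<in> sets borel} \<union>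
      null_sets (completion W) \<subseteq> sets (completion W)"
    by auto
  from sets.sigma_sets_subset[OF this] show ?thesis
    unfolding brownian_filtration_def sets_measure_of[OF brownian_filtration_generators] by simp
qed

lemma stopping_time_exit_time:
  fixes Y :: "real \<Rightarrow> real^'d::finite \<Rightarrow> 'r::finite path \<Rightarrow> real^'d"
  assumes cont: "\<And>\<omega>. \<omega> \<in> space W \<Longrightarrow> continuous_on ({0..} \<times> UNIV) (\<lambda>(t, x). Y t x \<omega>)"
    and Y0: "\<And>\<omega> x. \<omega> \<in> space W \<Longrightarrow> Y 0 x \<omega> = x"
    and meas: "\<And>t x. 0 \<le> t \<Longrightarrow> Y t x \<in> borel_measurable (brownian_filtration W (ennreal t))"
    and R: "0 \<le> l" "l < R"
  shows "stopping_time (brownian_filtration W) (exit_time Y l R)"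
  unfolding stopping_time_def
proof
  fix t :: ennreal
  let ?F = "brownian_filtration W t"
  show "Measurable.pred ?F (\<lambda>\<omega>. exit_time Y l R \<omega> \<le> t)"
  proof (cases t)
    case (real r)
    obtain D :: "(real \<times> (real^'d)) set" where D: "countable D" "D \<subseteq> {0..r} \<times> cball 0 l"
        "{0..r} \<times> cball 0 l \<subseteq> closure D"
      by (rule separable)
    have "D \<noteq> {}" using D(3) real R by fastforce
    have ex_D: "(\<exists>p\<in>D. Q p) \<longleftrightarrow> (\<exists>n. Q (from_nat_into D n))" for Q
      using range_from_nat_into[OF \<open>D \<noteq> {}\<close> D(1)] by (metis (no_types) image_iff rangeI)
    have m: "Measurable.pred ?F (\<lambda>\<omega>. c < norm (Y (fst p) (snd p) \<omega>))" if "p \<in> D" for p c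
    proof -
      have "0 \<le> fst p" "ennreal (fst p) \<le> t" using that D(2) real by (auto intro: ennreal_leI)
      then have "Y (fst p) (snd p) \<in> borel_measurable ?F"
        using measurable_mono[OF order_refl refl sets_brownian_filtration_mono] meas
        by (metis (no_types, lifting) space_brownian_filtration subsetD)
      then show ?thesis by measurable
    qed
    have P: "Measurable.pred ?F (\<lambda>\<omega>. \<forall>m. \<exists>p\<in>D. R - inverse (real (Suc m)) < norm (Y (fst p) (snd p) \<omega>))"
      unfolding ex_D by (intro pred_intros_countable m from_nat_into \<open>D \<noteq> {}\<close>)
    have E: "exit_time Y l R \<omega> \<le> t \<longleftrightarrow>
        (\<forall>m. \<exists>p\<in>D. R - inverse (real (Suc m)) < norm (Y (fst p) (snd p) \<omega>))"
      if \<omega>: "\<omega> \<in> space ?F" for \<omega>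
    proof -
      let ?A = "{0..r} \<times> (cball 0 l :: (real^'d) set)" and ?h = "\<lambda>p. norm (Y (fst p) (snd p) \<omega>)"
      have ch: "continuous_on ?A ?h"
        using \<omega>
        by (intro continuous_intros continuous_on_subset[OF cont[unfolded case_prod_unfold]]) auto
      have cA: "compact ?A" by (intro compact_Times) auto
      have ne: "?A \<noteq> {}" using real R by auto
      have clD: "closure D = ?A"
        using D cA by (intro antisym closure_minimal compact_imp_closed) auto
      have "(\<exists>p\<in>?A. R \<le> ?h p) \<longleftrightarrow> (\<forall>m. \<exists>p\<in>D. R - inverse (real (Suc m)) < ?h p)"
      proof
        assume "\<exists>p\<in>?A. R \<le> ?h p"
        then obtain p where p: "p \<in> ?A" "R \<le> ?h p" by blast
        show "\<forall>m. \<exists>p\<in>D. R - inverse (real (Suc m)) < ?h p"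
        proof (rule allI, rule ccontr)
          fix m
          assume "\<not> (\<exists>p\<in>D. R - inverse (real (Suc m)) < ?h p)"
          then have "?h q \<le> R - inverse (real (Suc m))" if "q \<in> D" for q
            using that by (force simp: not_less)
          with ch p(1) have "?h p \<le> R - inverse (real (Suc m))"
            unfolding clD[symmetric] by (rule continuous_le_on_closure)
          moreover have "0 < inverse (real (Suc m))" by simp
          ultimately show False using p(2) by linarith
        qed
      next
        assume *: "\<forall>m. \<exists>p\<in>D. R - inverse (real (Suc m)) < ?h p"
        obtain p where p: "p \<in> ?A" "\<And>q. q \<in> ?A \<Longrightarrow> ?h q \<le> ?h p"
          using continuous_attains_sup[OF cA ne ch] by blast
        have "R \<le> ?h p"
        proof (rule ccontr)
          assume "\<not> R \<le> ?h p"
          then obtain m where m: "inverse (real (Suc m)) < R - ?h p"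
            using reals_Archimedean[of "R - ?h p"] by auto
          from * obtain q where q: "q \<in> D" "R - inverse (real (Suc m)) < ?h q" by blast
          then have "?h q \<le> ?h p" using p(2) D(2) by blast
          with m q(2) show False by linarith
        qed
        with p(1) show "\<exists>p\<in>?A. R \<le> ?h p" by blast
      qed
      moreover have "exit_time Y l R \<omega> \<le> t \<longleftrightarrow> (\<exists>s\<in>{0..r}. \<exists>x\<in>cball 0 l. R \<le> norm (Y s x \<omega>))"
        using exit_time_le_iff[of Y \<omega> l R r] cont[of \<omega>] Y0[of \<omega>] R \<omega> real by simp
      ultimately show ?thesis by simp
    qed
    show ?thesis by (rule measurable_cong[THEN iffD2, OF E P])
  qed simp
qed

theorem proposition2p8:
  fixes W :: "(real \<Rightarrow> real^'r::finite) measure"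
    and \<sigma> :: "real^'d::finite \<Rightarrow> real^'r^'d"
    and b :: "real^'d \<Rightarrow> real^'d"
    and X :: "real \<Rightarrow> real^'d \<Rightarrow> (real \<Rightarrow> real^'r) \<Rightarrow> real^'d"
    and N\<^sub>0 :: "(real \<Rightarrow> real^'r) set"
    and \<psi> :: "(real^'d \<Rightarrow> real) \<Rightarrow> real"
    and K V :: "(real^'d) set"
    and N :: nat
    and g :: "('d \<Rightarrow> nat) \<Rightarrow> real^'d \<Rightarrow> real"
    and P :: "('d \<Rightarrow> nat) \<Rightarrow> ('d \<Rightarrow> nat) \<Rightarrow> 'd cpoly"
    and l :: real
  assumes "wiener_measure W"
    and "\<And>i j. smooth_bounded_derivs (\<lambda>x. \<sigma> x $ i $ j)"
    and "\<And>i. smooth_bounded_derivs (\<lambda>x. b x $ i)"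
    and "diffeo_flow W \<sigma> b X N\<^sub>0"
    and "\<And>\<alpha>. chain_rule_polys \<alpha> (P \<alpha>)"
    and "distribution \<psi>" and "compact K" and "dist_supp \<psi> \<subseteq> K"
    and "N = dist_order \<psi> + 2 * CARD('d)"
    and "open V" and "compact (closure V)" and "K \<subseteq> V"
    and "\<And>\<alpha>. midx_len \<alpha> \<le> N \<Longrightarrow> continuous_on UNIV (g \<alpha>) \<and> fun_supp (g \<alpha>) \<subseteq> V"
    and "\<And>\<phi>. test_function \<phi> \<Longrightarrow>
           \<psi> \<phi> = (\<Sum>\<alpha> | midx_len \<alpha> \<le> N. dist_deriv \<alpha> (dist_of_fun (g \<alpha>)) \<phi>)"
    and "l > 0" and "V \<subseteq> cball 0 l"
  shows "locally_compact_support W (Z_process N\<^sub>0 N V g P X) \<and>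
    (\<forall>R\<ge>0. \<forall>t\<ge>0. \<forall>\<omega>\<in>space W.
       ennreal t \<le> exit_time X l R \<omega> \<and> (0 < t \<or> l \<le> R) \<longrightarrow>
       dist_supp (Z_process N\<^sub>0 N V g P X t \<omega>) \<subseteq> cball 0 R) \<and>
    (\<forall>\<omega>\<in>space W - N\<^sub>0.
       mono_on {0..} (\<lambda>R. exit_time X l R \<omega>) \<and>
       ((\<lambda>R. exit_time X l R \<omega>) \<longlongrightarrow> \<top>) at_top)"
proof -
  \<comment> \<open>The flow, replaced by the identity on \<open>N\<^sub>0\<close>: it stays adapted, since the filtration contains
    the null sets, and becomes smooth and continuous for every \<open>\<omega>\<close>.\<close>
  define Y where "Y t x \<omega> = (if \<omega> \<in> N\<^sub>0 then x else X t x \<omega>)" for t x \<omega>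
  let ?Z = "Z_process N\<^sub>0 N V g P X"
  have N0: "N\<^sub>0 \<in> null_sets (completion W)"
    and sol: "\<And>x. sde_solution W \<sigma> b x (\<lambda>t. X t x)"
    and flow: "\<And>\<omega>. \<omega> \<in> space W - N\<^sub>0 \<Longrightarrow> (\<forall>x. X 0 x \<omega> = x) \<and>
        continuous_on ({0..} \<times> UNIV) (\<lambda>(t, x). X t x \<omega>) \<and> (\<forall>t\<ge>0. smooth_diffeo (\<lambda>x. X t x \<omega>))"
    using assms(4) unfolding diffeo_flow_def by auto
  have gcont: "continuous_on UNIV (g \<alpha>)" if "midx_len \<alpha> \<le> N" for \<alpha>
    using assms(13) that by blast
  have Ysmooth: "smooth_map (\<lambda>x. Y t x \<omega>)" if "\<omega> \<in> space W" "0 \<le> t" for t \<omega>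
    using flow[of \<omega>] that smooth_map_ident unfolding Y_def smooth_diffeo_def
    by (cases "\<omega> \<in> N\<^sub>0") auto
  have Ycont: "continuous_on ({0..} \<times> UNIV) (\<lambda>(t, x). Y t x \<omega>)" if "\<omega> \<in> space W" for \<omega>
    using flow[of \<omega>] that unfolding Y_def
    by (cases "\<omega> \<in> N\<^sub>0") (auto simp: case_prod_unfold intro!: continuous_intros)
  have Y0: "Y 0 x \<omega> = x" if "\<omega> \<in> space W" for x \<omega>
    using flow[of \<omega>] that unfolding Y_def by (cases "\<omega> \<in> N\<^sub>0") auto
  have Ymeas: "Y t x \<in> borel_measurable (brownian_filtration W (ennreal t))" if "0 \<le> t" for t x
  proof -
    have "N\<^sub>0 \<inter> space (brownian_filtration W (ennreal t)) \<in> sets (brownian_filtration W (ennreal t))"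
      by (intro sets.Int null_sets_brownian_filtration[OF N0] sets.top)
    moreover have "X t x \<in> borel_measurable (brownian_filtration W (ennreal t))"
      using sol[of x] that unfolding sde_solution_def by blast
    ultimately show ?thesis
      unfolding Y_def by (intro measurable_If_set) auto
  qed
  have Ymeas': "Y t x \<in> borel_measurable (completion W)" if "0 \<le> t" for t x
    using measurable_mono[OF order_refl refl sets_brownian_filtration_completion[OF assms(1)]]
      Ymeas[OF that] by (metis (no_types, lifting) space_brownian_filtration space_completion subsetD)

  have supp: "dist_supp (?Z t \<omega>) \<subseteq> cball 0 R"
    if "\<omega> \<in> space W" "\<omega> \<notin> N\<^sub>0 \<Longrightarrow> ennreal t \<le> exit_time X l R \<omega>" "0 \<le> t" "0 < t \<or> l \<le> R" for t R \<omega>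
  proof (rule dist_supp_Z_process_subset)
    fix x
    assume "\<omega> \<notin> N\<^sub>0" "x \<in> V"
    then have \<omega>: "\<omega> \<in> space W - N\<^sub>0" and x: "x \<in> cball 0 l" using that(1) assms(16) by auto
    show "X t x \<omega> \<in> cball 0 R"
    proof (cases "0 < t")
      case True
      then show ?thesis
        using norm_le_of_le_exit_time[of X \<omega> t l R x] flow[OF \<omega>] that(2) x \<open>\<omega> \<notin> N\<^sub>0\<close> by simp
    next
      case False
      then have "t = 0" "l \<le> R" using that by auto
      then show ?thesis using flow[OF \<omega>] x by simp
    qed
  qed simp

  have dual: "dual_process (completion W) ?Z"
    unfolding dual_process_def
  proof (intro allI impI conjI ballI)
    fix t :: real and \<omega>
    assume "0 \<le> t" "\<omega> \<in> space (completion W)"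
    then show "compact_distribution (?Z t \<omega>)"
      using flow[of \<omega>] assms(10,15,16)
      by (intro compact_distribution_Z_process[where l = l] gcont) (simp_all add: smooth_diffeo_def)
  next
    fix t :: real and \<phi> :: "real^'d \<Rightarrow> real"
    assume t: "0 \<le> t" and \<phi>: "smooth \<phi>"
    show "(\<lambda>\<omega>. ?Z t \<omega> \<phi>) \<in> borel_measurable (completion W)"
    proof (rule borel_measurable_Z_process[where Y = "Y t"])
      show "N\<^sub>0 \<in> sets (completion W)" using N0 by (rule null_setsD2)
      show "smooth_map (\<lambda>x. Y t x \<omega>)" if "\<omega> \<in> space (completion W)" for \<omega>
        using Ysmooth t that by simp
    qed (simp_all add: Ymeas' t \<phi> gcont assms(10) Y_def)
  qed

  define \<tau> where "\<tau> n = exit_time Y l (l + real n + 1)" for n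
  have "locally_compact_support W ?Z"
    unfolding locally_compact_support_def
  proof (intro conjI dual exI[of _ \<tau>] exI[of _ "\<lambda>n. cball 0 (l + real n + 1)"] allI ballI)
    show "stopping_time (brownian_filtration W) (\<tau> n)" for n
      unfolding \<tau>_def using assms(15) by (intro stopping_time_exit_time Ycont Y0 Ymeas) auto
    show "incseq (\<lambda>n. \<tau> n \<omega>)" for \<omega>
      unfolding \<tau>_def by (intro monoI exit_time_mono) auto
    show "(\<lambda>n. \<tau> n \<omega>) \<longlonglongrightarrow> (\<top>::ennreal)" if "\<omega> \<in> space W" for \<omega>
    proof -
      have "filterlim (\<lambda>n. (l + 1) + real n) at_top sequentially"
        by (rule filterlim_tendsto_add_at_top[OF tendsto_const filterlim_real_sequentially])
      then have "filterlim (\<lambda>n. l + real n + 1) at_top sequentially"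
        by (simp add: algebra_simps)
      then show ?thesis
        unfolding \<tau>_def
        by (rule filterlim_compose[OF exit_time_tendsto_top[where X = Y and \<omega> = \<omega>, OF Ycont[OF that]]])
    qed
    show "incseq (\<lambda>n. cball (0 :: real^'d) (l + real n + 1))"
      by (intro monoI subset_cball) auto
    show "AE \<omega> in completion W. \<forall>t\<ge>0.
        dist_supp (?Z (enn2real (min (ennreal t) (\<tau> n \<omega>))) \<omega>) \<subseteq> cball 0 (l + real n + 1)" for n
    proof (rule AE_I2, intro allI impI)
      fix \<omega> and t :: real
      assume \<omega>: "\<omega> \<in> space (completion W)" and "0 \<le> t"
      define s where "s = enn2real (min (ennreal t) (\<tau> n \<omega>))"
      have "min (ennreal t) (\<tau> n \<omega>) \<le> ennreal t" by simp
      also have "\<dots> < \<top>" by simp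
      finally have "ennreal s = min (ennreal t) (\<tau> n \<omega>)"
        unfolding s_def by (rule ennreal_enn2real)
      then have s: "ennreal s \<le> \<tau> n \<omega>" by simp
      show "dist_supp (?Z s \<omega>) \<subseteq> cball 0 (l + real n + 1)"
      proof (rule supp)
        show "ennreal s \<le> exit_time X l (l + real n + 1) \<omega>" if "\<omega> \<notin> N\<^sub>0"
          using s that by (simp add: \<tau>_def exit_time_def Y_def)
        show "\<omega> \<in> space W" using \<omega> by simp
        show "0 \<le> s" unfolding s_def by (rule enn2real_nonneg)
      qed simp
    qed
  qed simp
  moreover have "mono_on {0..} (\<lambda>R. exit_time X l R \<omega>) \<and>
       ((\<lambda>R. exit_time X l R \<omega>) \<longlongrightarrow> \<top>) at_top" if "\<omega> \<in> space W - N\<^sub>0" for \<omega>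
    using exit_time_tendsto_top[of X \<omega> l] flow[OF that]
    by (intro conjI mono_onI exit_time_mono) simp_all
  moreover have "\<forall>R\<ge>0. \<forall>t\<ge>0. \<forall>\<omega>\<in>space W.
      ennreal t \<le> exit_time X l R \<omega> \<and> (0 < t \<or> l \<le> R) \<longrightarrow> dist_supp (?Z t \<omega>) \<subseteq> cball 0 R"
    by (intro allI impI ballI, rule supp) simp_all
  ultimately show ?thesis by (intro conjI ballI) simp_all
qed

end
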